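(* Let $N\ge 1$ and $K>N$ be integers and consider the caching problem with $N$ files and $K$ users, each equipped with a cache of the same (normalized) size $M$, where $0\le M\le 1/K$. Then the rate $R(M)=N(1-M)$ is achievable with cache size $M$ (i.e. the pair $(M,N(1-M))$ is achievable) and it coincides with the cut-set bound: $$N(1-M)=\max_{s\in\{1,\dots,\min(N,K)\}}\left(s-\frac{s}{\lfloor N/s\rfloor}M\right).$$
   Context: Caching problem with $N$ files and $K$ users. A server holds $N$ independent files $W_1,\dots,W_N$, each uniformly distributed on $\{0,1\}^F$ ($F$ bits per file). All $K$ users are connected to the server through one shared error-free link, so that every user receives everything the server transmits. Each user has a cache. The system works in two phases. Placement phase (before demands are known): user $k$ stores in its cache $Z_k=\varphi_k(W_1,\dots,W_N)$, where $\varphi_k$ is an arbitrary function. Delivery phase: each user $k$ requests one full file $W_{d_k}$; the demand vector $d=(d_1,\dots,d_K)\in\{1,\dots,N\}^K$ is arbitrary and known to the server and all users. The server broadcasts $X_d=\psi_d(W_1,\dots,W_N)$, and user $k$ forms an estimate $\hat W_{d,k}=\mu_{d,k}(X_d,Z_k)$ of $W_{d_k}$. The functions $\varphi_k,\psi_d,\mu_{d,k}$ form a caching scheme for file size $F$; its error probability is $\max_{d}\max_{k}\Pr(\hat W_{d,k}\neq W_{d_k})$. Cache sizes and rates are normalized by the file size. A cache-rate pair $(M,R)$ with $M,R\ge 0$ is called achievable if for every $\varepsilon>0$ and all sufficiently large $F$ there is a caching scheme for file size $F$ in which each $Z_k$ takes at most $2^{(M+\varepsilon)F}$ values, each $X_d$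 (for every demand $d$) takes at most $2^{(R+\varepsilon)F}$ values, and the error probability is less than $\varepsilon$. The rate $R$ is thus a peak (worst-case over demands) rate. Cut-set bound (known from the earlier literature, Maddah-Ali and Niesen): every achievable pair $(M,R)$ satisfies $R\ge \max_{s\in\{1,\dots,\min(N,K)\}}\left(s-\frac{s}{\lfloor N/s\rfloor}M\right)$; the right-hand side is called the cut-set bound. *)

theory Defs
  imports "HOL-Probability.Probability"
begin

type_synonym bits = "bool list"

text \<open>The file library is a map from file indices \<open>{1..N}\<close> to bit strings (and the default
  \<open>[]\<close> outside of \<open>{1..N}\<close>); a demand vector maps the users \<open>{1..K}\<close> to file indices.\<close>

type_synonym files = "nat \<Rightarrow> bits"
type_synonym demand = "nat \<Rightarrow> nat"

definition files_pmf :: "nat \<Rightarrow> nat \<Rightarrow> files pmf" where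
  "files_pmf N F = Pi_pmf {1..N} [] (\<lambda>_. pmf_of_set {w. length w = F})"

definition demands :: "nat \<Rightarrow> nat \<Rightarrow> demand set" where
  "demands N K = {1..K} \<rightarrow>\<^sub>E {1..N}"

text \<open>Cache contents and broadcast messages are encoded as bit strings of unconstrained length.
  This only serves as an infinite supply of labels: their size is measured by the number of values
  taken, so a bit string of variable length carries no hidden information for free.\<close>

record caching_scheme =
  placement :: "nat \<Rightarrow> files \<Rightarrow> bits"
  delivery :: "demand \<Rightarrow> files \<Rightarrow> bits"
  decoder :: "demand \<Rightarrow> nat \<Rightarrow> bits \<Rightarrow> bits \<Rightarrow> bits"

definition estimate :: "caching_scheme \<Rightarrow> demand \<Rightarrow> nat \<Rightarrow> files \<Rightarrow> bits" where
  "estimate S d k W = decoder S d k (delivery S d W) (placement S k W)"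

text \<open>Both maxima are over nonempty sets only if \<open>N \<ge> 1\<close> and \<open>K \<ge> 1\<close>.\<close>

definition error_probability :: "nat \<Rightarrow> nat \<Rightarrow> nat \<Rightarrow> caching_scheme \<Rightarrow> real" where
  "error_probability N K F S =
     (MAX d\<in>demands N K. MAX k\<in>{1..K}.
        measure_pmf.prob (files_pmf N F) {W. estimate S d k W \<noteq> W (d k)})"

definition num_values :: "nat \<Rightarrow> nat \<Rightarrow> (files \<Rightarrow> bits) \<Rightarrow> nat" where
  "num_values N F f = card (f ` set_pmf (files_pmf N F))"

definition achievable :: "nat \<Rightarrow> nat \<Rightarrow> real \<Rightarrow> real \<Rightarrow> bool" where
  "achievable N K M R \<longleftrightarrow> M \<ge> 0 \<and> R \<ge> 0 \<and>
     (\<forall>\<epsilon>>0. \<forall>\<^sub>F F in sequentially. \<exists>S.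
        (\<forall>k\<in>{1..K}. real (num_values N F (placement S k)) \<le> 2 powr ((M + \<epsilon>) * real F)) \<and>
        (\<forall>d\<in>demands N K. real (num_values N F (delivery S d)) \<le> 2 powr ((R + \<epsilon>) * real F)) \<and>
        error_probability N K F S < \<epsilon>)"

definition cut_set_bound :: "nat \<Rightarrow> nat \<Rightarrow> real \<Rightarrow> real" where
  "cut_set_bound N K M =
     (MAX s\<in>{1..min N K}. real s - real s / of_int \<lfloor>real N / real s\<rfloor> * M)"

end

theory Submission
  imports Defs
begin

text \<open>Let \<open>m = \<lfloor>M F\<rfloor>\<close>, so that \<open>K m \<le> F\<close>, and cut the first \<open>K m\<close> bits of every file into \<open>K\<close> blocks
  of \<open>m\<close> bits, one block per user. User \<open>k\<close> caches the bitwise sum over all files of their \<open>k\<close>-th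
  blocks. If every file is requested, choose for each file \<open>n\<close> one user \<open>r n\<close> requesting it. Of file
  \<open>n\<close>, the server sends all bits except those in the block of \<open>r n\<close>, but it masks each block
  belonging to another requester of \<open>n\<close> with the block of \<open>r n\<close>; this costs \<open>N (F - m)\<close> bits. A user
  receives its own block of every file it does not request unmasked, so its cache reveals its
  own block of the requested file, and this block removes the masks. If some file is not requested,
  sending the requested files costs at most \<open>(N - 1) F \<le> N (F - m)\<close> bits, because \<open>N m \<le> K m \<le> F\<close>.\<close>

section \<open>Error-free schemes from families of bits, and parity cancellation\<close>

lemma set_files_pmf:
  "set_pmf (files_pmf N F) = PiE_dflt {1..N} [] (\<lambda>_. {w. length w = F})"
proof -
  have "finite {w :: bits. length w = F}"
    using finite_lists_length_eq[of "UNIV :: bool set" F] by simp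
  moreover have "{w :: bits. length w = F} \<noteq> {}"
    using Ex_list_of_length by blast
  ultimately have "set_pmf (pmf_of_set {w :: bits. length w = F}) = {w. length w = F}"
    by (intro set_pmf_of_set)
  then show ?thesis
    by (simp add: files_pmf_def set_Pi_pmf comp_def)
qed

lemma length_file:
  assumes "W \<in> set_pmf (files_pmf N F)" "n \<in> {1..N}"
  shows "length (W n) = F"
  using assms by (auto simp: set_files_pmf PiE_dflt_def)

lemma num_values_le_length:
  assumes "\<And>W. length (f W) = L"
  shows "num_values N F f \<le> 2 ^ L"
proof -
  have "num_values N F f \<le> card {w :: bits. length w = L}"
    unfolding num_values_def using assms finite_lists_length_eq[of "UNIV :: bool set" L]
    by (intro card_mono) auto
  also have "\<dots> = 2 ^ L"
    using card_lists_length_eq[of "UNIV :: bool set" L] by simp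
  finally show ?thesis .
qed

lemma ex_bits_encoding:
  fixes g :: "'i \<Rightarrow> files \<Rightarrow> bool"
  assumes "finite I"
  obtains enc :: "files \<Rightarrow> bits" where "\<And>W. length (enc W) = card I"
    "\<And>W W'. enc W = enc W' \<Longrightarrow> \<forall>i\<in>I. g i W = g i W'"
proof -
  obtain xs where xs: "set xs = I" "distinct xs"
    using finite_distinct_list[OF assms] by blast
  show ?thesis
    by (rule that[of "\<lambda>W. map (\<lambda>i. g i W) xs"]) (use xs distinct_card[OF xs(2)] in auto)
qed

lemma error_probability_eq_0:
  assumes "N \<ge> 1" "K \<ge> 1"
    and "\<And>d k W. d \<in> demands N K \<Longrightarrow> k \<in> {1..K} \<Longrightarrow> W \<in> set_pmf (files_pmf N F) \<Longrightarrow>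
      estimate S d k W = W (d k)"
  shows "error_probability N K F S = 0"
proof -
  have prob: "measure_pmf.prob (files_pmf N F) {W. estimate S d k W \<noteq> W (d k)} = 0"
    if "d \<in> demands N K" "k \<in> {1..K}" for d k
    using assms(3)[OF that] by (subst measure_pmf_zero_iff) auto
  \<comment> \<open>The constant demand for file 1 keeps the outer maximum from being a
    \<open>Max\<close> of the empty set; \<open>K \<ge> 1\<close> does so for the inner one.\<close>
  have "(\<lambda>_\<in>{1..K}. 1) \<in> demands N K"
    using assms by (auto simp: demands_def)
  then have "demands N K \<noteq> {}" by blast
  moreover have "(MAX k\<in>{1..K}. measure_pmf.prob (files_pmf N F) {W. estimate S d k W \<noteq> W (d k)})
      = 0" if "d \<in> demands N K" for d
  proof -
    have "(\<lambda>k. measure_pmf.prob (files_pmf N F) {W. estimate S d k W \<noteq> W (d k)}) ` {1..K} = {0}"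
      using prob[OF that] assms(2) by auto
    then show ?thesis by simp
  qed
  ultimately have "(\<lambda>d. MAX k\<in>{1..K}. measure_pmf.prob (files_pmf N F)
      {W. estimate S d k W \<noteq> W (d k)}) ` demands N K = {0}"
    by auto
  then show ?thesis by (simp add: error_probability_def)
qed

text \<open>No explicit decoder is needed: it may pick any library consistent with the message and
  the cache, since by \<open>dec\<close> all of these agree on the requested file. It remains to
  name the stored and sent bits and count them.\<close>

lemma ex_zero_error_scheme:
  fixes g :: "nat \<Rightarrow> 'i \<Rightarrow> files \<Rightarrow> bool" and h :: "demand \<Rightarrow> 'j \<Rightarrow> files \<Rightarrow> bool"
  assumes "N \<ge> 1" "K \<ge> 1"
    and fin: "\<And>k. finite (A k)" "\<And>d. finite (B d)"
    and dec: "\<And>d k W W'. \<lbrakk>d \<in> demands N K; k \<in> {1..K};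
      W \<in> set_pmf (files_pmf N F); W' \<in> set_pmf (files_pmf N F);
      \<forall>i\<in>A k. g k i W = g k i W'; \<forall>j\<in>B d. h d j W = h d j W'\<rbrakk> \<Longrightarrow> W (d k) = W' (d k)"
  obtains S where "\<And>k. num_values N F (placement S k) \<le> 2 ^ card (A k)"
    "\<And>d. num_values N F (delivery S d) \<le> 2 ^ card (B d)"
    "error_probability N K F S = 0"
proof -
  have "\<forall>k. \<exists>e :: files \<Rightarrow> bits. (\<forall>W. length (e W) = card (A k)) \<and>
      (\<forall>W W'. e W = e W' \<longrightarrow> (\<forall>i\<in>A k. g k i W = g k i W'))"
    using ex_bits_encoding[OF fin(1)] by metis
  then obtain p where p: "\<And>k W. length (p k W :: bits) = card (A k)"
      "\<And>k W W'. p k W = p k W' \<Longrightarrow> \<forall>i\<in>A k. g k i W = g k i W'"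
    by metis
  have "\<forall>d. \<exists>e :: files \<Rightarrow> bits. (\<forall>W. length (e W) = card (B d)) \<and>
      (\<forall>W W'. e W = e W' \<longrightarrow> (\<forall>j\<in>B d. h d j W = h d j W'))"
    using ex_bits_encoding[OF fin(2)] by metis
  then obtain q where q: "\<And>d W. length (q d W :: bits) = card (B d)"
      "\<And>d W W'. q d W = q d W' \<Longrightarrow> \<forall>j\<in>B d. h d j W = h d j W'"
    by metis
  define S where "S = \<lparr>placement = p, delivery = q,
    decoder = (\<lambda>d k x z. (SOME W. W \<in> set_pmf (files_pmf N F) \<and> q d W = x \<and> p k W = z) (d k))\<rparr>"
  have "estimate S d k W = W (d k)"
    if "d \<in> demands N K" "k \<in> {1..K}" and W: "W \<in> set_pmf (files_pmf N F)" for d k W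
  proof -
    \<comment> \<open>The library picked by the decoder; the true \<open>W\<close> witnesses that a
      consistent one exists.\<close>
    define W' where "W' = (SOME V. V \<in> set_pmf (files_pmf N F) \<and> q d V = q d W \<and> p k V = p k W)"
    have "W' \<in> set_pmf (files_pmf N F) \<and> q d W' = q d W \<and> p k W' = p k W"
      unfolding W'_def by (rule someI[of _ W]) (use W in auto)
    then have "W' (d k) = W (d k)"
      using dec[OF that(1,2), of W' W] W p(2)[of k W' W] q(2)[of d W' W] by simp
    then show ?thesis by (simp add: estimate_def S_def W'_def)
  qed
  then have "error_probability N K F S = 0"
    using assms(1,2) by (intro error_probability_eq_0)
  moreover have "num_values N F (placement S k) \<le> 2 ^ card (A k)" for k
    by (intro num_values_le_length) (simp add: S_def p(1))
  moreover have "num_values N F (delivery S d) \<le> 2 ^ card (B d)" for d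
    by (intro num_values_le_length) (simp add: S_def q(1))
  ultimately show ?thesis by (intro that)
qed

text \<open>The parity of the count is the sum of the truth values modulo 2, so equal terms cancel.
  This extracts one file's bit from a cached sum.\<close>

lemma odd_card_Collect_cancel:
  assumes "finite A" "a \<in> A" "\<And>x. x \<in> A \<Longrightarrow> x \<noteq> a \<Longrightarrow> P x = Q x"
    and "odd (card {x\<in>A. P x}) = odd (card {x\<in>A. Q x})"
  shows "P a = Q a"
proof -
  have split: "card {x\<in>A. R x} = card {x\<in>A - {a}. R x} + of_bool (R a)" for R
  proof -
    have "{x\<in>A. R x} = (if R a then insert a {x\<in>A - {a}. R x} else {x\<in>A - {a}. R x})"
      using assms(2) by auto
    then show ?thesis using assms(1) by simp
  qed
  have "{x\<in>A - {a}. P x} = {x\<in>A - {a}. Q x}"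
    using assms(3) by auto
  then show ?thesis
    using assms(4) split[of P] split[of Q] by (auto simp: of_bool_def split: if_splits)
qed

subsection \<open>The coded scheme\<close>

text \<open>The block of user \<open>k\<close> consists of the positions \<open>(k - 1) m + i\<close> with \<open>i < m\<close>.\<close>

definition cached_bit :: "nat \<Rightarrow> nat \<Rightarrow> nat \<Rightarrow> nat \<Rightarrow> files \<Rightarrow> bool" where
  "cached_bit N m k i W = odd (card {n\<in>{1..N}. W n ! ((k - 1) * m + i)})"

definition representative :: "nat \<Rightarrow> demand \<Rightarrow> nat \<Rightarrow> nat" where
  "representative K d n = (SOME k. k \<in> {1..K} \<and> d k = n)"

definition sent_positions :: "nat \<Rightarrow> nat \<Rightarrow> nat \<Rightarrow> nat \<Rightarrow> demand \<Rightarrow> (nat \<times> nat) set" where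
  "sent_positions N K F m d =
    (if d ` {1..K} = {1..N}
     then SIGMA n:{1..N}. {..<F} - (\<lambda>i. (representative K d n - 1) * m + i) ` {..<m}
     else d ` {1..K} \<times> {..<F})"

text \<open>On booleans \<open>\<noteq>\<close> is addition modulo 2. Since users are numbered from
  1, \<open>Suc (t div m)\<close> is the user whose block contains position \<open>t\<close>, and
  \<open>t mod m\<close> is the offset in that block.\<close>

definition sent_bit :: "nat \<Rightarrow> nat \<Rightarrow> nat \<Rightarrow> demand \<Rightarrow> nat \<times> nat \<Rightarrow> files \<Rightarrow> bool" where
  "sent_bit N K m d = (\<lambda>(n, t) W.
    if d ` {1..K} = {1..N} \<and> t < K * m \<and> d (Suc (t div m)) = n
    then W n ! t \<noteq> W n ! ((representative K d n - 1) * m + t mod m)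
    else W n ! t)"

lemma representative:
  assumes "n \<in> d ` {1..K}"
  shows "representative K d n \<in> {1..K}" "d (representative K d n) = n"
proof -
  have "representative K d n \<in> {1..K} \<and> d (representative K d n) = n"
    unfolding representative_def by (rule someI_ex) (use assms in auto)
  then show "representative K d n \<in> {1..K}" "d (representative K d n) = n" by auto
qed

lemma block_position_less:
  fixes k m i K :: nat
  assumes "k \<in> {1..K}" "i < m"
  shows "(k - 1) * m + i < K * m"
proof -
  have "(k - 1) * m + i < (k - 1) * m + m" using assms by simp
  also have "\<dots> = k * m" using assms by (cases k) auto
  also have "\<dots> \<le> K * m" using assms by simp
  finally show ?thesis .
qed

lemma finite_sent_positions: "finite (sent_positions N K F m d)"
  by (auto simp: sent_positions_def)

text \<open>The bound \<open>K * m \<le> F\<close> serves both cases: it keeps each omitted block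
  inside its file, and with \<open>N < K\<close> it makes the \<open>F\<close> bits of one
  unrequested file cover the saving \<open>N * m\<close>.\<close>

lemma card_sent_positions:
  assumes "N < K" "K * m \<le> F" "d \<in> demands N K"
  shows "card (sent_positions N K F m d) \<le> N * (F - m)"
proof (cases "d ` {1..K} = {1..N}")
  case True
  have "card ({..<F} - (\<lambda>i. (representative K d n - 1) * m + i) ` {..<m}) = F - m"
    if "n \<in> {1..N}" for n
  proof -
    have "(\<lambda>i. (representative K d n - 1) * m + i) ` {..<m} \<subseteq> {..<F}"
    proof clarify
      fix i assume "i < m"
      moreover have "representative K d n \<in> {1..K}"
        using representative(1) that True by blast
      ultimately have "(representative K d n - 1) * m + i < K * m"
        by (intro block_position_less)
      with assms(2) show "(representative K d n - 1) * m + i < F" by linarith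
    qed
    then show ?thesis
      by (simp add: card_Diff_subset card_image)
  qed
  with True show ?thesis
    by (simp add: sent_positions_def)
next
  case False
  have "d ` {1..K} \<subset> {1..N}"
    using assms(3) False by (auto simp: demands_def)
  then have "card (d ` {1..K}) < card {1..N}"
    by (intro psubset_card_mono) auto
  then have "card (d ` {1..K}) \<le> N - 1"
    by simp
  then have "card (d ` {1..K}) * F \<le> (N - 1) * F"
    by (rule mult_le_mono1)
  also have "\<dots> = N * F - F" by (simp add: diff_mult_distrib)
  also have "\<dots> \<le> N * F - N * m"
  proof (rule diff_le_mono2)
    have "N * m \<le> K * m" using assms(1) by simp
    then show "N * m \<le> F" using assms(2) by linarith
  qed
  finally show ?thesis
    using False by (simp add: sent_positions_def card_cartesian_product diff_mult_distrib2)
qed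

text \<open>Two libraries with the same observations are compared. If all files are requested,
  agreement in file \<open>d k\<close> spreads from the block of user \<open>k\<close> to the
  representative's block, which is the mask, and then to all other positions.\<close>

lemma sent_bits_decodable:
  assumes m: "K * m \<le> F" and d: "d \<in> demands N K" and k: "k \<in> {1..K}"
    and W: "W \<in> set_pmf (files_pmf N F)" "W' \<in> set_pmf (files_pmf N F)"
    and cached: "\<forall>i\<in>{..<m}. cached_bit N m k i W = cached_bit N m k i W'"
    and sent: "\<forall>p\<in>sent_positions N K F m d. sent_bit N K m d p W = sent_bit N K m d p W'"
  shows "W (d k) = W' (d k)"
proof -
  have dk: "d k \<in> {1..N}" using d k by (auto simp: demands_def)
  have "W (d k) ! t = W' (d k) ! t" if t: "t < F" for t
  proof (cases "d ` {1..K} = {1..N}")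
    case False
    then have "(d k, t) \<in> sent_positions N K F m d"
      using k t by (auto simp: sent_positions_def)
    with sent have "sent_bit N K m d (d k, t) W = sent_bit N K m d (d k, t) W'" by blast
    then show ?thesis using False by (simp add: sent_bit_def)
  next
    case True
    let ?r = "representative K d"
    have r: "?r n \<in> {1..K}" "d (?r n) = n" if "n \<in> {1..N}" for n
      using representative[of n d K] that True by auto
    have sent': "sent_bit N K m d (n, s) W = sent_bit N K m d (n, s) W'"
      if "n \<in> {1..N}" "s < F" "\<not> (\<exists>i<m. s = (?r n - 1) * m + i)" for n s
    proof -
      have "(n, s) \<in> sent_positions N K F m d"
        using that True by (auto simp: sent_positions_def)
      with sent show ?thesis by blast
    qed
    have block: "((j - 1) * m + i) div m = j - 1" "((j - 1) * m + i) mod m = i"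
      if "i < m" for i j :: nat
      using that by auto
    \<comment> \<open>Blocks of distinct users are disjoint: division by \<open>m\<close> recovers
      \<open>j - 1\<close>, and hence \<open>j\<close> because users start at 1.\<close>
    have outside: "\<not> (\<exists>i'<m. (j - 1) * m + i = (?r n - 1) * m + i')"
      if "i < m" "j \<in> {1..K}" "n \<in> {1..N}" "j \<noteq> ?r n" for i j n
    proof
      assume "\<exists>i'<m. (j - 1) * m + i = (?r n - 1) * m + i'"
      then have "j - 1 = ?r n - 1" using block(1) that(1) by metis
      then show False using that r(1)[of n] by auto
    qed
    \<comment> \<open>User \<open>k\<close> does not request a file \<open>n\<close> other than
      \<open>d k\<close>, so its block of \<open>n\<close> is sent, and unmasked. These terms cancel
      in the cached parity.\<close>
    have own: "W (d k) ! ((k - 1) * m + i) = W' (d k) ! ((k - 1) * m + i)" if i: "i < m" for i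
    proof (rule odd_card_Collect_cancel[of "{1..N}" "d k"])
      fix n assume n: "n \<in> {1..N}" "n \<noteq> d k"
      then have "k \<noteq> ?r n" using r(2) by auto
      moreover have "(k - 1) * m + i < F"
        using block_position_less[OF k i] m by simp
      ultimately show "W n ! ((k - 1) * m + i) = W' n ! ((k - 1) * m + i)"
        using sent'[OF n(1) _ outside[OF i k n(1)]] n k block(1)[OF i, of k]
        by (auto simp: sent_bit_def)
    qed (use dk cached i in \<open>auto simp: cached_bit_def\<close>)
    have mask: "W (d k) ! ((?r (d k) - 1) * m + i) = W' (d k) ! ((?r (d k) - 1) * m + i)"
      if i: "i < m" for i
    proof (cases "k = ?r (d k)")
      case True
      then show ?thesis using own[OF i] by simp
    next
      case False
      have lt: "(k - 1) * m + i < K * m" by (rule block_position_less[OF k i])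
      \<comment> \<open>This sent bit adds the own block to the representative's block; the former
        is already known by \<open>own\<close>.\<close>
      have "sent_bit N K m d (d k, (k - 1) * m + i) W = sent_bit N K m d (d k, (k - 1) * m + i) W'"
        using sent'[OF dk _ outside[OF i k dk False]] lt m by simp
      then show ?thesis
        using lt True k block[OF i, of k] own[OF i] by (auto simp: sent_bit_def)
    qed
    \<comment> \<open>Three kinds of position remain: omitted, masked and plain.\<close>
    show ?thesis
    proof (cases "\<exists>i<m. t = (?r (d k) - 1) * m + i")
      case True
      then show ?thesis using mask by blast
    next
      case False
      show ?thesis
      proof (cases "t < K * m \<and> d (Suc (t div m)) = d k")
        case True
        \<comment> \<open>Here \<open>t < K * m\<close> excludes \<open>m = 0\<close>.\<close>
        then have "t mod m < m" by (cases "m = 0") auto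
        then show ?thesis
          using sent'[OF dk t False] True \<open>d ` {1..K} = {1..N}\<close> mask[of "t mod m"]
          by (auto simp: sent_bit_def)
      next
        case uncoded: False
        have "sent_bit N K m d (d k, t) V = V (d k) ! t" for V
          using uncoded unfolding sent_bit_def by auto
        then show ?thesis
          using sent'[OF dk t False] by simp
      qed
    qed
  qed
  then show ?thesis
    using length_file[OF W(1) dk] length_file[OF W(2) dk] by (intro nth_equalityI) auto
qed

subsection \<open>Achievability and the cut-set bound\<close>

lemma achievable_small_cache:
  assumes "N \<ge> 1" and "K > N" and "0 \<le> M" and "M \<le> 1 / real K"
  shows "achievable N K M (real N * (1 - M))"
proof -
  have KM: "real K * M \<le> 1" using assms by (simp add: field_simps)
  \<comment> \<open>\<open>M \<le> 1\<close> makes the rate nonnegative, as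
    \<open>achievable\<close> requires.\<close>
  have "1 / real K \<le> 1" using assms by simp
  then have "M \<le> 1" using assms(4) by linarith
  have "\<forall>\<^sub>F F in sequentially. \<exists>S.
        (\<forall>k\<in>{1..K}. real (num_values N F (placement S k)) \<le> 2 powr ((M + \<epsilon>) * real F)) \<and>
        (\<forall>d\<in>demands N K. real (num_values N F (delivery S d))
          \<le> 2 powr ((real N * (1 - M) + \<epsilon>) * real F)) \<and>
        error_probability N K F S < \<epsilon>" if eps: "\<epsilon> > 0" for \<epsilon>
    \<comment> \<open>Rounding \<open>M * real F\<close> down to \<open>m\<close> costs less than
      one extra sent bit per file; from \<open>N / \<epsilon>\<close> on, these at most
      \<open>N\<close> bits fit into \<open>\<epsilon> * real F\<close>.\<close>
    using eventually_ge_at_top[of "nat \<lceil>real N / \<epsilon>\<rceil>"]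
  proof eventually_elim
    case (elim F)
    have F: "real N \<le> \<epsilon> * real F"
    proof -
      have "real N / \<epsilon> \<le> real F" using elim by linarith
      then show ?thesis using eps by (simp add: field_simps)
    qed
    define m where "m = nat \<lfloor>M * real F\<rfloor>"
    have "0 \<le> M * real F" using assms by simp
    then have m: "real m \<le> M * real F" "M * real F < real m + 1"
      unfolding m_def by linarith+
    have "real (K * m) \<le> real K * M * real F"
      using m(1) mult_left_mono[of "real m" "M * real F" "real K"] by (simp add: mult.assoc)
    also have "\<dots> \<le> real F"
      using KM mult_right_mono[of "real K * M" 1 "real F"] by simp
    finally have Km: "K * m \<le> F" by (simp only: of_nat_le_iff)
    have "m \<le> K * m" using assms by simp
    with Km have "m \<le> F" by linarith
    obtain S where S: "\<And>k. num_values N F (placement S k) \<le> 2 ^ card {..<m}"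
      "\<And>d. num_values N F (delivery S d) \<le> 2 ^ card (sent_positions N K F m d)"
      "error_probability N K F S = 0"
    proof (rule ex_zero_error_scheme[where N = N and K = K and F = F and A = "\<lambda>_. {..<m}"
          and B = "sent_positions N K F m" and g = "cached_bit N m" and h = "sent_bit N K m"])
      show "W (d k) = W' (d k)" if "d \<in> demands N K" "k \<in> {1..K}"
        "W \<in> set_pmf (files_pmf N F)" "W' \<in> set_pmf (files_pmf N F)"
        "\<forall>i\<in>{..<m}. cached_bit N m k i W = cached_bit N m k i W'"
        "\<forall>p\<in>sent_positions N K F m d. sent_bit N K m d p W = sent_bit N K m d p W'" for d k W W'
        by (rule sent_bits_decodable[OF Km that])
    qed (use assms in \<open>auto simp: finite_sent_positions intro: that\<close>)
    have le_powr: "real x \<le> 2 powr y" if "x \<le> 2 ^ l" "real l \<le> y" for x l y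
    proof -
      have "real x \<le> 2 ^ l" using that(1) by (metis of_nat_le_iff of_nat_numeral of_nat_power)
      also have "\<dots> = 2 powr real l" by (simp add: powr_realpow)
      also have "\<dots> \<le> 2 powr y" using that(2) by simp
      finally show ?thesis .
    qed
    have "real m \<le> (M + \<epsilon>) * real F"
      using m(1) F by (simp add: distrib_right)
    moreover have "real (card (sent_positions N K F m d)) \<le> (real N * (1 - M) + \<epsilon>) * real F"
      if "d \<in> demands N K" for d
    proof -
      have "real (card (sent_positions N K F m d)) \<le> real (N * (F - m))"
        using card_sent_positions[OF assms(2) Km that] by (simp only: of_nat_le_iff)
      also have "\<dots> = real N * (real F - real m)"
        using \<open>m \<le> F\<close> by (simp add: of_nat_diff)
      also have "\<dots> \<le> real N * (real F - M * real F + 1)"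
        using m(2) by (intro mult_left_mono) auto
      also have "\<dots> \<le> (real N * (1 - M) + \<epsilon>) * real F"
        using F by (simp add: algebra_simps)
      finally show ?thesis .
    qed
    ultimately show ?case
      using S(3) eps le_powr[OF S(1)] le_powr[OF S(2)] by (intro exI[of _ S]) simp
  qed
  then show ?thesis
    using assms \<open>M \<le> 1\<close> by (simp add: achievable_def)
qed

text \<open>The maximum is attained at \<open>s = N\<close>, where the floor is 1. For
  \<open>s < N\<close>, dropping the subtracted term leaves at most \<open>N - 1\<close>, and
  \<open>N * M \<le> K * M \<le> 1\<close>.\<close>

lemma cut_set_bound_small_cache:
  assumes "N \<ge> 1" and "K > N" and "0 \<le> M" and "M \<le> 1 / real K"
  shows "cut_set_bound N K M = real N * (1 - M)"
  unfolding cut_set_bound_def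
proof (rule Max_eqI)
  show "real N * (1 - M) \<in> (\<lambda>s. real s - real s / of_int \<lfloor>real N / real s\<rfloor> * M) ` {1..min N K}"
    using assms by (intro image_eqI[of _ _ N]) (auto simp: algebra_simps)
next
  fix y assume "y \<in> (\<lambda>s. real s - real s / of_int \<lfloor>real N / real s\<rfloor> * M) ` {1..min N K}"
  then obtain s where s: "1 \<le> s" "s \<le> N"
    and y: "y = real s - real s / of_int \<lfloor>real N / real s\<rfloor> * M"
    by auto
  show "y \<le> real N * (1 - M)"
  proof (cases "s = N")
    case True
    then show ?thesis using y assms by (simp add: algebra_simps)
  next
    case False
    have "0 \<le> real s / of_int \<lfloor>real N / real s\<rfloor> * M"
      using assms by simp
    then have "y \<le> real s" using y by simp
    moreover have "real s \<le> real N - 1" using s False by linarith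
    moreover have "real N * M \<le> real K * M"
      using assms by (intro mult_right_mono) auto
    moreover have "real K * M \<le> 1" using assms by (simp add: field_simps)
    ultimately show ?thesis by (simp add: algebra_simps)
  qed
qed simp

theorem theorem4:
  fixes N K :: nat and M :: real
  assumes "N \<ge> 1" and "K > N"
    and "0 \<le> M" and "M \<le> 1 / real K"
  shows "achievable N K M (real N * (1 - M)) \<and>
    real N * (1 - M) = cut_set_bound N K M"
  using achievable_small_cache[OF assms] cut_set_bound_small_cache[OF assms] by simp

end
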